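(* There exists a sequence of finite simple graphs $\{G_n\}_{n\ge 1}$ such that $\mathrm{scc}'(G_n)/\mathrm{scc}(G_n)\to\infty$ as $n\to\infty$.
   Context: All graphs are finite, simple and undirected. A clique of a graph $G$ is a set of pairwise adjacent vertices; its size is its number of vertices. A clique covering of $G$ is a family of cliques of $G$ such that every edge of $G$ lies in at least one of them. The clique cover number $\mathrm{cc}(G)$ is the minimum number of cliques in a clique covering of $G$. The sigma clique cover number $\mathrm{scc}(G)$ is the minimum of $\sum_{C\in\mathcal{C}}|C|$ over all clique coverings $\mathcal{C}$ of $G$. Further, $\mathrm{scc}'(G)=\min\{\sum_{C\in\mathcal{C}}|C| : \mathcal{C}\text{ a clique covering of } G \text{ with } |\mathcal{C}|=\mathrm{cc}(G)\}$. *)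

theory Defs
  imports Complex_Main "Graph_Theory.Pair_Digraph"
begin

text \<open>
  Finite simple undirected graphs are those satisfying \<^const>\<open>pair_graph\<close>: finite, loop-free and
  symmetric, where an undirected edge is represented by its two opposite arcs.
\<close>

definition clique :: "'a pair_pre_digraph \<Rightarrow> 'a set \<Rightarrow> bool" where
  "clique G C \<longleftrightarrow> C \<subseteq> pverts G \<and> (\<forall>u\<in>C. \<forall>v\<in>C. u \<noteq> v \<longrightarrow> (u, v) \<in> parcs G)"

definition clique_covering :: "'a pair_pre_digraph \<Rightarrow> 'a set set \<Rightarrow> bool" where
  "clique_covering G \<C> \<longleftrightarrow>
    (\<forall>C\<in>\<C>. clique G C) \<and> (\<forall>(u, v)\<in>parcs G. \<exists>C\<in>\<C>. u \<in> C \<and> v \<in> C)"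

definition clique_cover_number :: "'a pair_pre_digraph \<Rightarrow> nat" (\<open>cc\<close>) where
  "cc G = (LEAST k. \<exists>\<C>. clique_covering G \<C> \<and> k = card \<C>)"

definition sigma_clique_cover_number :: "'a pair_pre_digraph \<Rightarrow> nat" (\<open>scc\<close>) where
  "scc G = (LEAST k. \<exists>\<C>. clique_covering G \<C> \<and> k = (\<Sum>C\<in>\<C>. card C))"

definition sigma_clique_cover_number' :: "'a pair_pre_digraph \<Rightarrow> nat" (\<open>scc''\<close>) where
  "scc' G = (LEAST k. \<exists>\<C>. clique_covering G \<C> \<and> card \<C> = cc G \<and> k = (\<Sum>C\<in>\<C>. card C))"

text \<open>
  For finite simple graphs all sets and sums above are finite, and the three minima are attained.
\<close>

context pair_graph
begin

lemma clique_covering_finite: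
  assumes "clique_covering G \<C>"
  shows "finite \<C>" and "C \<in> \<C> \<Longrightarrow> finite C"
proof -
  have sub: "\<C> \<subseteq> Pow (pverts G)"
    using assms by (auto simp: clique_covering_def clique_def)
  then show "finite \<C>"
    using pair_finite_verts by (meson finite_Pow_iff finite_subset)
  show "finite C" if "C \<in> \<C>"
    using that sub pair_finite_verts by (meson PowD finite_subset subsetD)
qed

lemma clique_covering_exists: "\<exists>\<C>. clique_covering G \<C>"
proof
  have "(v, u) \<in> parcs G" if "(u, v) \<in> parcs G" for u v
    using that pair_sym_arcs by (auto simp: symmetric_def dest: symD)
  then show "clique_covering G ((\<lambda>(u, v). {u, v}) ` parcs G)"
    by (auto simp: clique_covering_def clique_def dest: in_arcsD1 in_arcsD2)
qed

lemma cc_attained: "\<exists>\<C>. clique_covering G \<C> \<and> cc G = card \<C>"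
  unfolding clique_cover_number_def by (rule LeastI_ex) (use clique_covering_exists in blast)

lemma scc_attained: "\<exists>\<C>. clique_covering G \<C> \<and> scc G = (\<Sum>C\<in>\<C>. card C)"
  unfolding sigma_clique_cover_number_def
  by (rule LeastI_ex) (use clique_covering_exists in blast)

lemma scc'_attained:
  "\<exists>\<C>. clique_covering G \<C> \<and> card \<C> = cc G \<and> scc' G = (\<Sum>C\<in>\<C>. card C)"
  unfolding sigma_clique_cover_number'_def
  by (rule LeastI_ex) (metis cc_attained)

end

end

theory Submission
  imports Defs
begin

text \<open>
  Let \<open>A\<close> and \<open>B\<close> be disjoint cliques on \<open>n\<close> vertices joined by a perfect matching, let \<open>D\<close> be a
  further clique on \<open>n\<close> vertices, all adjacent to all of \<open>A \<union> B\<close>, and add two vertices, one adjacent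
  exactly to \<open>A\<close> and the other exactly to \<open>B\<close>. No two of the \<open>n\<close> matching edges and the edges at
  the two additional vertices share a clique, so \<open>n + 2\<close> cliques are necessary; they also suffice.
  In a covering with \<open>n + 2\<close> cliques, the edges from \<open>D\<close> to \<open>A\<close> can only be covered by the cliques
  of the matching edges, hence each of these \<open>n\<close> cliques contains \<open>D\<close> and the total size is at
  least \<open>n\<^sup>2\<close>. Adding the cliques \<open>A \<union> D\<close> and \<open>B \<union> D\<close> makes \<open>D\<close> superfluous in all other cliques
  and yields a covering of linear total size.
\<close>

text \<open>The generating family is itself a clique covering, so presenting a graph this way bounds
  \<open>cc\<close> from above at once.\<close>

definition union_of_cliques :: "'a set set \<Rightarrow> 'a pair_pre_digraph" where
  "union_of_cliques \<F> =
    \<lparr>pverts = \<Union>\<F>, parcs = {(u, v). u \<noteq> v \<and> (\<exists>C\<in>\<F>. u \<in> C \<and> v \<in> C)}\<rparr>"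

lemma pair_graph_union_of_cliques:
  assumes "finite \<F>" and "\<And>C. C \<in> \<F> \<Longrightarrow> finite C"
  shows "pair_graph (union_of_cliques \<F>)"
proof -
  have fin: "finite (\<Union>\<F>)"
    using assms by blast
  moreover have "parcs (union_of_cliques \<F>) \<subseteq> \<Union>\<F> \<times> \<Union>\<F>"
    by (auto simp: union_of_cliques_def)
  ultimately have "finite (parcs (union_of_cliques \<F>))"
    by (meson finite_SigmaI finite_subset)
  with fin show ?thesis
    by unfold_locales
      (auto simp: union_of_cliques_def symmetric_def intro!: symI)
qed

lemma clique_covering_union_of_cliques: "clique_covering (union_of_cliques \<F>) \<F>"
  by (auto simp: clique_covering_def clique_def union_of_cliques_def)

lemma cc_le: "clique_covering G \<C> \<Longrightarrow> cc G \<le> card \<C>"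
  unfolding clique_cover_number_def by (rule Least_le) blast

lemma scc_le: "clique_covering G \<C> \<Longrightarrow> scc G \<le> (\<Sum>C\<in>\<C>. card C)"
  unfolding sigma_clique_cover_number_def by (rule Least_le) blast

lemma (in pair_graph) scc_pos:
  assumes "(u, v) \<in> parcs G"
  shows "scc G > 0"
proof -
  obtain \<C> where \<C>: "clique_covering G \<C>" "scc G = (\<Sum>C\<in>\<C>. card C)"
    using scc_attained by blast
  then obtain C where C: "C \<in> \<C>" "u \<in> C"
    using assms by (auto simp: clique_covering_def)
  with \<C> have "card C > 0"
    using clique_covering_finite(2) card_gt_0_iff by blast
  also have "card C \<le> scc G"
    using \<C> C clique_covering_finite(1) by (auto intro: member_le_sum)
  finally show ?thesis .
qed

text \<open>
  \<open>A\<close>, \<open>B\<close>, \<open>D\<close> are the consecutive intervals of length \<open>n\<close> starting at 0, the matching edges are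
  \<open>{i, n + i}\<close>, and the two additional vertices are \<open>3n\<close> and \<open>3n + 1\<close>.
\<close>

definition matched_cliques :: "nat \<Rightarrow> nat set set" where
  "matched_cliques n = {insert (3*n) {..<n}, insert (3*n + 1) {n..<2*n}} \<union>
    (\<lambda>i. {i, n + i} \<union> {2*n..<3*n}) ` {..<n}"

abbreviation gap_graph :: "nat \<Rightarrow> nat pair_pre_digraph" where
  "gap_graph n \<equiv> union_of_cliques (matched_cliques n)"

lemma gap_graph_arc_iff:
  "(u, v) \<in> parcs (gap_graph n) \<longleftrightarrow> u \<noteq> v \<and>
    ({u, v} \<subseteq> insert (3*n) {..<n} \<or> {u, v} \<subseteq> insert (3*n + 1) {n..<2*n} \<or>
     (\<exists>i<n. {u, v} \<subseteq> {i, n + i} \<union> {2*n..<3*n}))"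
  by (auto simp: union_of_cliques_def matched_cliques_def)

lemma pair_graph_gap_graph: "pair_graph (gap_graph n)"
  by (rule pair_graph_union_of_cliques) (auto simp: matched_cliques_def)

text \<open>Keeps the quotient in the final limit away from division by zero.\<close>

lemma scc_gap_graph_pos:
  assumes "n \<ge> 1"
  shows "scc (gap_graph n) > 0"
proof (rule pair_graph.scc_pos[OF pair_graph_gap_graph])
  show "(0, n) \<in> parcs (gap_graph n)"
    using assms by (auto simp: gap_graph_arc_iff)
qed

lemma cc_gap_graph_le: "cc (gap_graph n) \<le> n + 2"
proof -
  have "cc (gap_graph n) \<le> card (matched_cliques n)"
    by (rule cc_le) (rule clique_covering_union_of_cliques)
  also have "\<dots> \<le> 2 + n"
    unfolding matched_cliques_def
    by (intro order_trans[OF card_Un_le] add_mono)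
      (auto intro: card_image_le[THEN order_trans] simp: card_insert_if)
  finally show ?thesis by simp
qed

lemma scc'_gap_graph_ge:
  assumes "n \<ge> 1"
  shows "n * n \<le> scc' (gap_graph n)"
proof -
  interpret pair_graph "gap_graph n" by (rule pair_graph_gap_graph)
  obtain \<C> where cov: "clique_covering (gap_graph n) \<C>"
    and card: "card \<C> = cc (gap_graph n)"
    and scc': "scc' (gap_graph n) = (\<Sum>C\<in>\<C>. card C)"
    using scc'_attained by blast
  have fin: "finite \<C>" "\<And>C. C \<in> \<C> \<Longrightarrow> finite C"
    using clique_covering_finite cov by blast+
  have covered: "\<exists>C\<in>\<C>. u \<in> C \<and> v \<in> C" if "(u, v) \<in> parcs (gap_graph n)" for u v
    using cov that by (auto simp: clique_covering_def)
  have adj: "(u, v) \<in> parcs (gap_graph n)" if "C \<in> \<C>" "u \<in> C" "v \<in> C" "u \<noteq> v" for C u v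
    using cov that by (auto simp: clique_covering_def clique_def)

  \<comment> \<open>These are n + 2 edges no two of which share a clique: the matching edges, then
    one edge at each additional vertex. The endpoints 0 and n are arbitrary choices from A and B,
    which are nonempty as n \<ge> 1.\<close>
  define e where
    "e j = (if j < n then (j, n + j) else if j = n then (3*n, 0) else (3*n + 1, n))" for j
  have "e j \<in> parcs (gap_graph n)" if "j < n + 2" for j
    using that assms by (auto simp: e_def gap_graph_arc_iff)
  then have "\<forall>j\<in>{..<n + 2}. \<exists>C. C \<in> \<C> \<and> fst (e j) \<in> C \<and> snd (e j) \<in> C"
    by (metis covered lessThan_iff prod.collapse)
  then obtain f where f: "\<And>j. j < n + 2 \<Longrightarrow> f j \<in> \<C>"
    "\<And>j. j < n + 2 \<Longrightarrow> fst (e j) \<in> f j" "\<And>j. j < n + 2 \<Longrightarrow> snd (e j) \<in> f j"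
    by (metis lessThan_iff)
  have f_match: "j \<in> f j" "n + j \<in> f j" if "j < n" for j
    using f(2,3)[of j] that by (auto simp: e_def)
  have f_A: "3*n \<in> f n" and f_B: "3*n + 1 \<in> f (n + 1)"
    using f(2)[of n] f(2)[of "n + 1"] by (auto simp: e_def)

  \<comment> \<open>A common clique would contain a non-adjacent pair: an unmatched pair from A and
    B, an additional vertex with a vertex of the opposite side, or both additional vertices.\<close>
  have f_neq: "f i \<noteq> f j" if ij: "i < j" "j < n + 2" for i j
  proof
    assume eq: "f i = f j"
    consider "j < n" | "j = n" | "j = n + 1" "i < n" | "j = n + 1" "i = n"
      using ij by linarith
    then show False
    proof cases
      case 1
      then have "(i, n + j) \<in> parcs (gap_graph n)"
        using adj[of "f i" i "n + j"] f(1) f_match[of i] f_match[of j] eq ij by auto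
      then show False using 1 ij by (auto simp: gap_graph_arc_iff)
    next
      case 2
      then have "(n + i, 3*n) \<in> parcs (gap_graph n)"
        using adj[of "f i" "n + i" "3*n"] f(1) f_match[of i] f_A eq ij by auto
      then show False using 2 ij by (auto simp: gap_graph_arc_iff)
    next
      case 3
      then have "(i, 3*n + 1) \<in> parcs (gap_graph n)"
        using adj[of "f i" i "3*n + 1"] f(1) f_match[of i] f_B eq ij by auto
      then show False using 3 ij by (auto simp: gap_graph_arc_iff)
    next
      case 4
      then have "(3*n, 3*n + 1) \<in> parcs (gap_graph n)"
        using adj[of "f i" "3*n" "3*n + 1"] f(1)[of i] f_A f_B eq by simp
      then show False using assms by (auto simp: gap_graph_arc_iff)
    qed
  qed
  then have inj: "inj_on f {..<n + 2}"
    by (metis inj_onI lessThan_iff linorder_neqE_nat)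
  \<comment> \<open>The covering has \<open>cc\<close> \<le> n + 2 members, so the n + 2 distinct
    cliques \<open>f j\<close> leave room for no other.\<close>
  have range: "f ` {..<n + 2} = \<C>"
  proof (rule card_seteq)
    show "card \<C> \<le> card (f ` {..<n + 2})"
      using card cc_gap_graph_le[of n] card_image[OF inj] by simp
  qed (use fin f(1) in auto)

  \<comment> \<open>The edge from \<open>i\<close> to \<open>d\<close> is covered by some
    \<open>f j\<close>. Any \<open>j\<close> other than \<open>i\<close> would put a non-adjacent
    pair into it: \<open>i\<close> with \<open>n + j\<close>, or \<open>d\<close> with an additional
    vertex.\<close>
  have D_sub: "{2*n..<3*n} \<subseteq> f i" if i: "i < n" for i
  proof
    fix d assume d: "d \<in> {2*n..<3*n}"
    then have "(i, d) \<in> parcs (gap_graph n)"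
      using i by (auto simp: gap_graph_arc_iff)
    then obtain j where j: "j < n + 2" "i \<in> f j" "d \<in> f j"
      using covered range by (metis imageE lessThan_iff)
    consider "j < n" "j = i" | "j < n" "j \<noteq> i" | "j = n" | "j = n + 1"
      using j by linarith
    then show "d \<in> f i"
    proof cases
      case 1
      then show ?thesis using j by simp
    next
      case 2
      then have "(i, n + j) \<in> parcs (gap_graph n)"
        using adj[of "f j" i "n + j"] f(1) f_match[of j] j i by auto
      then show ?thesis using 2 i by (auto simp: gap_graph_arc_iff)
    next
      case 3
      then have "(d, 3*n) \<in> parcs (gap_graph n)"
        using adj[of "f j" d "3*n"] f(1) f_A j d by auto
      then show ?thesis using d by (auto simp: gap_graph_arc_iff)
    next
      case 4
      then have "(d, 3*n + 1) \<in> parcs (gap_graph n)"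
        using adj[of "f j" d "3*n + 1"] f(1) f_B j d by auto
      then show ?thesis using d by (auto simp: gap_graph_arc_iff)
    qed
  qed

  have "n * n = (\<Sum>i<n. card {2*n..<3*n})"
    by simp
  also have "\<dots> \<le> (\<Sum>i<n. card (f i))"
    using D_sub f(1) fin(2) by (intro sum_mono card_mono) auto
  also have "\<dots> \<le> (\<Sum>i<n + 2. card (f i))"
    by (rule sum_mono2) auto
  also have "\<dots> = (\<Sum>C\<in>\<C>. card C)"
    using sum.reindex[OF inj, of card] range by simp
  finally show ?thesis using scc' by simp
qed

lemma scc_gap_graph_le: "scc (gap_graph n) \<le> 8 * n + 2"
proof -
  \<comment> \<open>The last two sets are A \<union> D and B \<union> D. They cover all edges at D,
    so the matching cliques shrink to bare edges.\<close>
  define \<A> where "\<A> = {insert (3*n) {..<n}, insert (3*n + 1) {n..<2*n},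
    {..<n} \<union> {2*n..<3*n}, {n..<3*n}}"
  define \<M> where "\<M> = (\<lambda>i. {i, n + i}) ` {..<n}"
  have fin: "finite \<A>" "finite \<M>"
    by (simp_all add: \<A>_def \<M>_def)
  have "clique_covering (gap_graph n) (\<A> \<union> \<M>)"
    unfolding clique_covering_def
  proof (intro conjI ballI)
    fix C assume C: "C \<in> \<A> \<union> \<M>"
    have arc: "(u, v) \<in> parcs (gap_graph n)" if "u \<in> C" "v \<in> C" "u \<noteq> v" for u v
    proof -
      \<comment> \<open>The witness is the matching index of \<open>x\<close>. If \<open>x\<close>
        lies in D, any index works, and 0 is available since D is nonempty.\<close>
      have hub: "\<exists>i<n. {x, y} \<subseteq> {i, n + i} \<union> {2*n..<3*n}"
        if "x < 3*n" "y \<in> {2*n..<3*n}" for x y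
      proof -
        consider "x < n" | "n \<le> x" "x < 2*n" | "2*n \<le> x" by linarith
        then show ?thesis
        proof cases
          case 1 then show ?thesis using that by (intro exI[of _ x]) auto
        next
          case 2 then show ?thesis using that by (intro exI[of _ "x - n"]) auto
        next
          case 3 then show ?thesis using that by (intro exI[of _ 0]) auto
        qed
      qed
      have "C \<in> \<M> \<or> C = insert (3*n) {..<n} \<or> C = insert (3*n + 1) {n..<2*n} \<or>
        C = {..<n} \<union> {2*n..<3*n} \<or> C = {n..<3*n}"
        using C by (auto simp: \<A>_def)
      moreover have "\<exists>i<n. {u, v} \<subseteq> {i, n + i} \<union> {2*n..<3*n}" if "C \<in> \<M>"
        using that \<open>u \<in> C\<close> \<open>v \<in> C\<close> by (auto simp: \<M>_def)
      moreover have "u < 3*n \<and> v < 3*n \<and> (u \<ge> 2*n \<or> v \<ge> 2*n \<or> u < n \<and> v < n)"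
        if "C = {..<n} \<union> {2*n..<3*n}"
        using that \<open>u \<in> C\<close> \<open>v \<in> C\<close> by auto
      moreover have "u < 3*n \<and> v < 3*n \<and> (u \<ge> 2*n \<or> v \<ge> 2*n \<or> u \<in> {n..<2*n} \<and> v \<in> {n..<2*n})"
        if "C = {n..<3*n}"
        using that \<open>u \<in> C\<close> \<open>v \<in> C\<close> by auto
      ultimately show ?thesis
        using that hub[of u v] hub[of v u] unfolding gap_graph_arc_iff
        by (smt (verit) atLeastLessThan_iff insert_commute insert_iff insert_subset
            empty_subsetI lessThan_iff)
    qed
    moreover have "C \<subseteq> pverts (gap_graph n)"
    proof
      fix x assume "x \<in> C"
      then consider "x < n" | "x \<in> {n..<2*n}" | "x \<in> {2*n..<3*n}"
        | "x = 3*n" | "x = 3*n + 1"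
        using C unfolding \<A>_def \<M>_def by force
      then show "x \<in> pverts (gap_graph n)"
        by cases (auto simp: union_of_cliques_def matched_cliques_def intro!: exI[of _ 0])
    qed
    ultimately show "clique (gap_graph n) C"
      by (auto simp: clique_def)
  next
    fix p assume "p \<in> parcs (gap_graph n)"
    then show "case p of (u, v) \<Rightarrow> \<exists>C\<in>\<A> \<union> \<M>. u \<in> C \<and> v \<in> C"
      by (cases p) (auto simp: gap_graph_arc_iff \<A>_def \<M>_def)
  qed
  then have "scc (gap_graph n) \<le> (\<Sum>C\<in>\<A> \<union> \<M>. card C)"
    by (rule scc_le)
  also have "\<dots> \<le> (\<Sum>C\<in>\<A>. card C) + (\<Sum>C\<in>\<M>. card C)"
    using sum_Un_nat[of \<A> \<M> card] by (simp add: fin)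
  \<comment> \<open>Only an inequality, because the four sets need not be distinct: for n = 0 the
    last two are both empty.\<close>
  also have "(\<Sum>C\<in>\<A>. card C) \<le> sum_list (map card [insert (3*n) {..<n},
      insert (3*n + 1) {n..<2*n}, {..<n} \<union> {2*n..<3*n}, {n..<3*n}])"
    unfolding \<A>_def by (simp add: sum.insert_if)
  also have "\<dots> \<le> 6 * n + 2"
    using card_Un_le[of "{..<n}" "{2*n..<3*n}"] by simp
  also have "(\<Sum>C\<in>\<M>. card C) \<le> (\<Sum>i<n. card {i, n + i})"
    unfolding \<M>_def by (rule sum_image_le[THEN order_trans]) auto
  also have "\<dots> \<le> (\<Sum>i<n. 2)"
    by (rule sum_mono) (simp add: card_insert_if)
  finally show ?thesis by simp
qed

theorem theorem1:
  shows "\<exists>G :: nat \<Rightarrow> nat pair_pre_digraph.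
    (\<forall>n\<ge>1. pair_graph (G n) \<and> scc (G n) > 0) \<and>
    filterlim (\<lambda>n. real (scc' (G n)) / real (scc (G n))) at_top sequentially"
proof (intro exI conjI allI impI)
  fix n :: nat assume n: "n \<ge> 1"
  show "pair_graph (gap_graph n)"
    by (rule pair_graph_gap_graph)
  show "scc (gap_graph n) > 0"
    using n by (rule scc_gap_graph_pos)
next
  have bound: "real n / 10 \<le> real (scc' (gap_graph n)) / real (scc (gap_graph n))"
    if n: "n \<ge> 1" for n
  proof -
    \<comment> \<open>The constant 10 comes from 8n + 2 \<le> 10n for n \<ge> 1.\<close>
    have "n * scc (gap_graph n) \<le> n * (10 * n)"
      using scc_gap_graph_le[of n] n by (intro mult_left_mono) linarith+
    also have "\<dots> \<le> 10 * scc' (gap_graph n)"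
      using scc'_gap_graph_ge[OF n] by simp
    finally have "real n * real (scc (gap_graph n)) \<le> 10 * real (scc' (gap_graph n))"
      by (metis of_nat_le_iff of_nat_mult of_nat_numeral)
    then show ?thesis using scc_gap_graph_pos[OF n] by (simp add: field_simps)
  qed
  have "filterlim (\<lambda>n. (1 / 10) * real n) at_top sequentially"
    by (rule filterlim_tendsto_pos_mult_at_top[OF tendsto_const _ filterlim_real_sequentially])
      simp
  then show "filterlim (\<lambda>n. real (scc' (gap_graph n)) / real (scc (gap_graph n)))
      at_top sequentially"
    by (rule filterlim_at_top_mono)
      (use bound in \<open>auto simp: eventually_sequentially intro!: exI[of _ 1]\<close>)
qed

end
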